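(* (i) Let $G$ be a profinite group, and let $H\unlhd G$. Then $\Phi^\lhd(H)\le\Phi^\lhd(G)$. (ii) Let $G$ be a profinite group such that $\Phi^\lhd(G)$ is trivial. Then $G$ is a Cartesian product of elementary abelian groups and non-abelian finite simple groups. In particular, $\mathrm{Fin}(G)$ is dense in $G$.
   Context: All subgroups are closed unless called abstract. The normal Frattini subgroup $\Phi^\lhd(G)$ of a profinite group $G$ is the intersection of all maximal closed normal subgroups of $G$, equivalently the intersection of the open normal subgroups $N$ such that $G/N$ is simple (with $\Phi^\lhd(1)=1$). The finite radical $\mathrm{Fin}(G)$ is the union of all finite normal subgroups of $G$; it is an abstract subgroup of $G$, not necessarily closed. *)

theory Defs
  imports
    "HOL-Analysis.Analysis"
    "HOL-Algebra.Product_Groups"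
    "HOL-Algebra.SimpleGroups"
begin

locale topological_group = group G for G (structure) +
  fixes T :: "'a topology"
  assumes topspace_eq_carrier: "topspace T = carrier G"
    and continuous_mult: "continuous_map (prod_topology T T) T (\<lambda>(x, y). x \<otimes> y)"
    and continuous_inv: "continuous_map T T (\<lambda>x. inv x)"

locale profinite_group = topological_group +
  assumes compact: "compact_space T"
    and Hausdorff: "Hausdorff_space T"
    and totally_disconnected:
      "\<And>x. x \<in> topspace T \<Longrightarrow> connected_component_of_set T x = {x}"

definition closed_subgroup :: "'a set \<Rightarrow> ('a, 'b) monoid_scheme \<Rightarrow> 'a topology \<Rightarrow> bool"
  where "closed_subgroup H G T \<longleftrightarrow> subgroup H G \<and> closedin T H"

definition closed_normal_subgroup :: "'a set \<Rightarrow> ('a, 'b) monoid_scheme \<Rightarrow> 'a topology \<Rightarrow> bool"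
  where "closed_normal_subgroup N G T \<longleftrightarrow> N \<lhd> G \<and> closedin T N"

definition maximal_closed_normal_subgroup ::
    "'a set \<Rightarrow> ('a, 'b) monoid_scheme \<Rightarrow> 'a topology \<Rightarrow> bool"
  where "maximal_closed_normal_subgroup N G T \<longleftrightarrow>
    closed_normal_subgroup N G T \<and> N \<noteq> carrier G \<and>
    (\<forall>M. closed_normal_subgroup M G T \<and> N \<subseteq> M \<longrightarrow> M = N \<or> M = carrier G)"

text \<open>The intersection is taken inside \<open>carrier G\<close>, so that the empty intersection is the
  whole group.  For a profinite group this only happens if the group is trivial, in which case it
  gives the usual convention that the normal Frattini subgroup of the trivial group is trivial.\<close>

definition normal_frattini :: "('a, 'b) monoid_scheme \<Rightarrow> 'a topology \<Rightarrow> 'a set"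
  where "normal_frattini G T =
    {x \<in> carrier G. \<forall>N. maximal_closed_normal_subgroup N G T \<longrightarrow> x \<in> N}"

definition finite_radical :: "('a, 'b) monoid_scheme \<Rightarrow> 'a set"
  where "finite_radical G = \<Union>{N. N \<lhd> G \<and> finite N}"

definition elementary_abelian :: "('a, 'b) monoid_scheme \<Rightarrow> bool"
  where "elementary_abelian A \<longleftrightarrow>
    comm_group A \<and> (\<exists>p::nat. prime p \<and> (\<forall>x \<in> carrier A. x [^]\<^bsub>A\<^esub> p = \<one>\<^bsub>A\<^esub>))"

definition topological_group_iso ::
    "('a \<Rightarrow> 'c) \<Rightarrow> ('a, 'b) monoid_scheme \<Rightarrow> 'a topology \<Rightarrow>
     ('c, 'd) monoid_scheme \<Rightarrow> 'c topology \<Rightarrow> bool"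
  where "topological_group_iso f G T H U \<longleftrightarrow> f \<in> iso G H \<and> homeomorphic_map T U f"

end

theory Submission
  imports Defs "HOL-Algebra.SndIsomorphismGrp" "HOL-Algebra.Zassenhaus"
    "HOL-Algebra.Multiplicative_Group"
begin

text \<open>
  Write \<open>\<Phi>(G)\<close> for the normal Frattini subgroup and let \<open>H\<close> be a closed normal subgroup of the
  profinite group \<open>G\<close>.  For \<open>\<Phi>(H) \<subseteq> \<Phi>(G)\<close> it suffices that \<open>\<Phi>(H) \<subseteq> M\<close> for every maximal closed
  normal subgroup \<open>M\<close> of \<open>G\<close>.  This is clear if \<open>H \<subseteq> M\<close>.  Otherwise \<open>M H = G\<close> by maximality of \<open>M\<close>,
  so that \<open>H / (M \<inter> H)\<close> is isomorphic to \<open>G / M\<close> and \<open>M \<inter> H\<close> is a maximal closed normal subgroup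
  of \<open>H\<close>; see \<open>maximal_closed_normal_subgroup_Int\<close>.  Of the topology one needs only that \<open>G\<close> is
  compact and Hausdorff, so that products of closed subgroups are closed.

  Now let \<open>\<Phi>(G)\<close> be trivial.  Maximal closed normal subgroups \<open>M\<close> are open
  (\<open>maximal_closed_normal_subgroup_open\<close>), because the open normal subgroups form a neighbourhood
  base of the identity; hence the quotients \<open>G / M\<close> are finite simple groups.  By Zorn's lemma
  there is a set \<open>I\<close> of such \<open>M\<close> that is maximal subject to the condition that \<open>G\<close> maps onto the
  product of the \<open>G / M\<close> over each finite subset of \<open>I\<close>.  If some maximal closed normal \<open>M\<close> did
  not contain \<open>K = \<Inter>I\<close>, then \<open>M K = G\<close>, and this allows one to add \<open>M\<close> to \<open>I\<close>
  (\<open>jointly_surjective_insert\<close>), contradicting maximality.  So \<open>K \<subseteq> \<Phi>(G)\<close> is trivial, and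
  \<open>G\<close> maps injectively to the full product of the quotients; by compactness it also maps onto it.
  Treating abelian and non-abelian quotients separately is unnecessary: a finite simple
  abelian group is elementary abelian.

  For the density of the finite radical, let \<open>F\<close> be a finite subset of \<open>I\<close>.  The intersection of
  all \<open>N \<in> I - F\<close> is a normal subgroup that embeds into the finite product of the \<open>G / N\<close> for
  \<open>N \<in> F\<close>, so it lies in the finite radical, and these intersections together meet every nonempty
  open set.
\<close>

section \<open>Normal subgroups and abelian simple groups\<close>

lemma (in group) subset_set_mult_left:
  assumes "subgroup M G" "subgroup N G"
  shows "M \<subseteq> M <#> N"
proof
  fix m assume m: "m \<in> M"
  then have "m = m \<otimes> \<one>" using subgroup.mem_carrier[OF assms(1)] by simp
  then show "m \<in> M <#> N"
    using m subgroup.one_closed[OF assms(2)] unfolding set_mult_def by blast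
qed

lemma (in group) subset_set_mult_right:
  assumes "subgroup M G" "subgroup N G"
  shows "N \<subseteq> M <#> N"
proof
  fix n assume n: "n \<in> N"
  then have "n = \<one> \<otimes> n" using subgroup.mem_carrier[OF assms(2)] by simp
  then show "n \<in> M <#> N"
    using n subgroup.one_closed[OF assms(1)] unfolding set_mult_def by blast
qed

lemma (in group) normal_Inter:
  assumes "\<And>N. N \<in> I \<Longrightarrow> N \<lhd> G"
  shows "carrier G \<inter> \<Inter>I \<lhd> G"
  unfolding normal_inv_iff
proof (intro conjI ballI)
  have "subgroup (\<Inter>(insert (carrier G) I)) G"
    using normal_imp_subgroup[OF assms] subgroup_self by (intro subgroups_Inter) auto
  then show "subgroup (carrier G \<inter> \<Inter>I) G" by simp
  show "x \<otimes> h \<otimes> inv x \<in> carrier G \<inter> \<Inter>I"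
    if "x \<in> carrier G" "h \<in> carrier G \<inter> \<Inter>I" for x h
    using that normal.inv_op_closed2[OF assms] by auto
qed

text \<open>If \<open>G = M H\<close> with \<open>M\<close> normal in \<open>G\<close>, then a normal subgroup \<open>N\<close> of \<open>H\<close> becomes normal modulo
  \<open>M\<close>: elements of \<open>H\<close> normalise \<open>N\<close>, and elements of \<open>M\<close> move \<open>N\<close> only within \<open>M N\<close>.\<close>

lemma (in group) normal_set_mult_of_normal_in_factor:
  assumes M: "M \<lhd> G" and H: "subgroup H G" and N: "N \<lhd> G\<lparr>carrier := H\<rparr>"
    and MH: "M <#> H = carrier G"
  shows "M <#> N \<lhd> G"
proof -
  interpret M: normal M G by fact
  interpret H: subgroup H G by fact
  interpret N: normal N "G\<lparr>carrier := H\<rparr>" by fact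
  have NH: "N \<subseteq> H" using N.subset by simp
  have Ns: "subgroup N G"
    using incl_subgroup[OF H N.subgroup_axioms] .
  have MNs: "subgroup (M <#> N) G" using mult_norm_subgroup[OF M Ns] .
  have "g \<otimes> x \<otimes> inv g \<in> M <#> N" if g: "g \<in> carrier G" and x: "x \<in> M <#> N" for g x
  proof -
    obtain m n where mn: "m \<in> M" "n \<in> N" "x = m \<otimes> n" using x by (auto simp: set_mult_def)
    have "g \<in> M <#> H" using g MH by simp
    then obtain k h where kh: "k \<in> M" "h \<in> H" "g = k \<otimes> h" by (auto simp: set_mult_def)
    have c: "m \<in> carrier G" "n \<in> carrier G" "k \<in> carrier G" "h \<in> carrier G"
      using mn kh NH by (auto intro: M.mem_carrier H.mem_carrier)
    \<comment> \<open>Conjugation by \<open>h \<in> H\<close> keeps \<open>n\<close> in \<open>N\<close>; conjugating the result \<open>n'\<close> by \<open>k \<in> M\<close> only adds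
      the left factor \<open>k (n' (inv k) (inv n'))\<close>, which lies in \<open>M\<close>.\<close>
    define n' where "n' = h \<otimes> n \<otimes> inv h"
    have n': "n' \<in> N"
      using N.inv_op_closed2[of h n] kh(2) mn(2) m_inv_consistent[OF H kh(2)] by (simp add: n'_def)
    then have n'c: "n' \<in> carrier G" using NH H.subset by blast
    have cancel: "inv a \<otimes> (a \<otimes> b) = b" if "a \<in> carrier G" "b \<in> carrier G" for a b
      using that by (simp flip: m_assoc)
    have "g \<otimes> x \<otimes> inv g = (g \<otimes> m \<otimes> inv g) \<otimes> (g \<otimes> n \<otimes> inv g)"
      using c g by (simp add: mn(3) m_assoc cancel)
    also have "g \<otimes> n \<otimes> inv g = k \<otimes> n' \<otimes> inv k"
      using c by (simp add: kh(3) n'_def m_assoc inv_mult_group)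
    also have "\<dots> = (k \<otimes> (n' \<otimes> inv k \<otimes> inv n')) \<otimes> n'"
      using c n'c by (simp add: m_assoc)
    also have "(g \<otimes> m \<otimes> inv g) \<otimes> \<dots> = (g \<otimes> m \<otimes> inv g) \<otimes> (k \<otimes> (n' \<otimes> inv k \<otimes> inv n')) \<otimes> n'"
      using c n'c g by (simp add: m_assoc)
    finally have "g \<otimes> x \<otimes> inv g =
        (g \<otimes> m \<otimes> inv g) \<otimes> (k \<otimes> (n' \<otimes> inv k \<otimes> inv n')) \<otimes> n'" .
    moreover have "g \<otimes> m \<otimes> inv g \<in> M" using g mn(1) by (rule M.inv_op_closed2)
    moreover have "n' \<otimes> inv k \<otimes> inv n' \<in> M"
      using n'c M.m_inv_closed[OF kh(1)] by (rule M.inv_op_closed2)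
    ultimately show ?thesis
      using kh(1) n' unfolding set_mult_def by (blast intro: M.m_closed)
  qed
  then show ?thesis unfolding normal_inv_iff using MNs by blast
qed

text \<open>For a prime \<open>p\<close> dividing the order of some element, the \<open>p\<close>-torsion of an abelian group is a
  nontrivial normal subgroup, hence everything if the group is simple.\<close>

lemma finite_simple_abelian_elementary:
  assumes "simple_group A" "comm_group A" "finite (carrier A)"
  shows "elementary_abelian A"
proof -
  interpret A: simple_group A by fact
  interpret A: comm_group A by fact
  obtain x where x: "x \<in> carrier A" "x \<noteq> \<one>\<^bsub>A\<^esub>"
    using A.simple_not_triv A.one_closed by blast
  define n where "n = A.ord x"
  have n0: "n > 0" using A.ord_ge_1[OF assms(3) x(1)] by (simp add: n_def)
  have n1: "n \<noteq> 1" using x A.ord_eq_1 by (simp add: n_def)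
  obtain p where p: "prime p" "p dvd n" using n1 prime_factor_nat by blast
  then obtain k where k: "n = k * p" by (metis dvd_def mult.commute)
  define y where "y = x [^]\<^bsub>A\<^esub> k"
  have y: "y \<in> carrier A" using x(1) by (simp add: y_def)
  have yp: "y [^]\<^bsub>A\<^esub> p = \<one>\<^bsub>A\<^esub>"
    using x(1) A.pow_ord_eq_1[OF x(1)] by (simp add: y_def A.nat_pow_pow k[symmetric] n_def)
  have y1: "y \<noteq> \<one>\<^bsub>A\<^esub>"
  proof
    assume "y = \<one>\<^bsub>A\<^esub>"
    then have "n dvd k" using A.pow_eq_id[OF x(1)] by (simp add: y_def n_def)
    then have "n \<le> k" using n0 k by (intro dvd_imp_le) auto
    then show False using k n0 prime_gt_1_nat[OF p(1)] by (cases "k = 0") auto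
  qed
  let ?S = "{a \<in> carrier A. a [^]\<^bsub>A\<^esub> p = \<one>\<^bsub>A\<^esub>}"
  have "subgroup ?S A"
  proof (rule A.subgroupI)
    show "?S \<noteq> {}" using y yp by blast
  qed (auto simp: A.nat_pow_distrib A.nat_pow_inv)
  then have "?S \<lhd> A" by (rule A.subgroup_imp_normal)
  then have "?S = carrier A" using A.no_real_normal_subgroup[of ?S] y yp y1 by blast
  then show ?thesis
    unfolding elementary_abelian_def using assms(2) p(1) by blast
qed

section \<open>Open subgroups and cosets in topological groups\<close>

context topological_group
begin

lemma continuous_map_mult:
  assumes "continuous_map X T f" "continuous_map X T g"
  shows "continuous_map X T (\<lambda>x. f x \<otimes> g x)"
  using continuous_map_compose[OF continuous_map_pairedI[OF assms] continuous_mult]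
  by (simp add: comp_def)

lemma continuous_map_right_translation:
  assumes "x \<in> carrier G"
  shows "continuous_map T T (\<lambda>g. g \<otimes> x)"
  by (intro continuous_map_mult) (auto simp: assms topspace_eq_carrier)

lemma r_coset_eq_preimage:
  assumes "subgroup N G" "x \<in> carrier G"
  shows "N #> x = {g \<in> topspace T. g \<otimes> inv x \<in> N}"
  using assms subgroup.rcos_module[OF assms(1) is_group assms(2)] subgroup.elemrcos_carrier[OF assms(1) is_group assms(2)]
  by (auto simp: topspace_eq_carrier)

lemma openin_r_coset:
  assumes "subgroup N G" "openin T N" "x \<in> carrier G"
  shows "openin T (N #> x)"
  unfolding r_coset_eq_preimage[OF assms(1,3)]
  by (intro openin_continuous_map_preimage[OF continuous_map_right_translation]) (use assms in auto)

lemma closedin_r_coset: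
  assumes "subgroup N G" "closedin T N" "x \<in> carrier G"
  shows "closedin T (N #> x)"
  unfolding r_coset_eq_preimage[OF assms(1,3)]
  by (intro closedin_continuous_map_preimage[OF continuous_map_right_translation]) (use assms in auto)

lemma openin_union_cosets:
  assumes "subgroup N G" "openin T N" "C \<subseteq> rcosets N"
  shows "openin T (\<Union>C)"
  using assms openin_r_coset by (force simp: RCOSETS_def)

lemma subgroup_containing_open_subgroup_open:
  assumes "subgroup N G" "openin T N" "subgroup M G" "N \<subseteq> M"
  shows "openin T M"
proof -
  have "M = \<Union>((\<lambda>x. N #> x) ` M)"
  proof
    show "M \<subseteq> \<Union>((\<lambda>x. N #> x) ` M)"
      using rcos_self[OF _ assms(1)] subgroup.subset[OF assms(3)] by blast
    show "\<Union>((\<lambda>x. N #> x) ` M) \<subseteq> M"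
      using assms(4) subgroup.m_closed[OF assms(3)] by (auto simp: r_coset_def)
  qed
  moreover have "openin T (\<Union>((\<lambda>x. N #> x) ` M))"
    using subgroup.subset[OF assms(3)]
    by (intro openin_union_cosets[OF assms(1,2)]) (auto simp: RCOSETS_def)
  ultimately show ?thesis by simp
qed

lemma open_subgroup_closed:
  assumes "subgroup N G" "openin T N"
  shows "closedin T N"
proof -
  have "openin T (\<Union>(rcosets N - {N}))"
    by (intro openin_union_cosets[OF assms]) auto
  moreover have "\<Union>(rcosets N - {N}) = topspace T - N"
  proof -
    have "N \<in> rcosets N" using subgroup.subgroup_in_rcosets[OF assms(1) is_group] .
    then have "\<Union>(rcosets N - {N}) = \<Union>(rcosets N) - N"
      using rcos_disjoint[OF assms(1)] unfolding pairwise_def disjnt_def by blast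
    then show ?thesis by (simp add: rcosets_part_G[OF assms(1)] topspace_eq_carrier)
  qed
  moreover have "N \<subseteq> topspace T" using subgroup.subset[OF assms(1)] by (simp add: topspace_eq_carrier)
  ultimately show ?thesis by (simp add: closedin_def)
qed

lemma open_subgroup_finite_index:
  assumes "compact_space T" "subgroup N G" "openin T N"
  shows "finite (rcosets N)"
proof -
  have "\<And>U. U \<in> rcosets N \<Longrightarrow> openin T U"
    using openin_r_coset[OF assms(2,3)] by (auto simp: RCOSETS_def)
  then obtain F where F: "finite F" "F \<subseteq> rcosets N" "topspace T \<subseteq> \<Union>F"
    using assms(1) rcosets_part_G[OF assms(2)]
    unfolding compact_space_alt topspace_eq_carrier by (metis subset_refl)
  have "rcosets N \<subseteq> F"
  proof
    fix C assume C: "C \<in> rcosets N"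
    then obtain x where x: "x \<in> C" using subgroup.rcosets_non_empty[OF assms(2)] by blast
    then have "x \<in> carrier G" using C rcosets_part_G[OF assms(2)] by blast
    then obtain D where D: "D \<in> F" "x \<in> D" using F(3) topspace_eq_carrier by blast
    then have "C = D" using x C F(2) rcos_disjoint[OF assms(2)] unfolding pairwise_def disjnt_def by blast
    then show "C \<in> F" using D by simp
  qed
  then show ?thesis using F(1) finite_subset by blast
qed

lemma closedin_set_mult:
  assumes "compact_space T" "Hausdorff_space T" "closedin T A" "closedin T B"
  shows "closedin T (A <#> B)"
proof -
  have "compactin (prod_topology T T) (A \<times> B)"
    using closedin_compact_space[OF assms(1,3)] closedin_compact_space[OF assms(1,4)]
    by (simp add: compactin_Times)
  then have "compactin T ((\<lambda>(x, y). x \<otimes> y) ` (A \<times> B))"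
    using image_compactin continuous_mult by blast
  moreover have "(\<lambda>(x, y). x \<otimes> y) ` (A \<times> B) = A <#> B"
    by (auto simp: set_mult_def)
  ultimately show ?thesis using assms(2) compactin_imp_closedin by fastforce
qed

text \<open>The elements that can be inserted into or deleted from any product \<open>x y\<close> without changing
  whether it lies in \<open>W\<close>.  This is always a normal subgroup, so that for a clopen \<open>W\<close> one obtains
  an open normal subgroup directly, without first taking an open subgroup and then its core.\<close>

definition translation_stabilizer :: "'a set \<Rightarrow> 'a set"
  where "translation_stabilizer W =
    {g \<in> carrier G. \<forall>x\<in>carrier G. \<forall>y\<in>carrier G. x \<otimes> g \<otimes> y \<in> W \<longleftrightarrow> x \<otimes> y \<in> W}"

lemma translation_stabilizer_normal: "translation_stabilizer W \<lhd> G"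
  unfolding normal_inv_iff
proof (intro conjI ballI)
  show "subgroup (translation_stabilizer W) G"
  proof (rule subgroupI)
    show "translation_stabilizer W \<subseteq> carrier G" by (auto simp: translation_stabilizer_def)
    have "\<one> \<in> translation_stabilizer W" by (auto simp: translation_stabilizer_def)
    then show "translation_stabilizer W \<noteq> {}" by blast
  next
    fix g assume g: "g \<in> translation_stabilizer W"
    then have gc: "g \<in> carrier G" by (simp add: translation_stabilizer_def)
    have "x \<otimes> inv g \<otimes> y \<in> W \<longleftrightarrow> x \<otimes> y \<in> W" if "x \<in> carrier G" "y \<in> carrier G" for x y
    proof -
      have "(x \<otimes> inv g) \<otimes> g \<otimes> y = x \<otimes> y"
        using that gc by (simp add: m_assoc)
      then show ?thesis using g that gc unfolding translation_stabilizer_def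
        by (metis (mono_tags, lifting) inv_closed m_closed mem_Collect_eq)
    qed
    then show "inv g \<in> translation_stabilizer W"
      using gc by (simp add: translation_stabilizer_def)
  next
    fix g h assume g: "g \<in> translation_stabilizer W" and h: "h \<in> translation_stabilizer W"
    then have c: "g \<in> carrier G" "h \<in> carrier G" by (simp_all add: translation_stabilizer_def)
    have "x \<otimes> (g \<otimes> h) \<otimes> y \<in> W \<longleftrightarrow> x \<otimes> y \<in> W" if xy: "x \<in> carrier G" "y \<in> carrier G" for x y
    proof -
      have "x \<otimes> (g \<otimes> h) \<otimes> y = (x \<otimes> g) \<otimes> h \<otimes> y" using c xy by (simp add: m_assoc)
      also have "\<dots> \<in> W \<longleftrightarrow> x \<otimes> g \<otimes> y \<in> W"
        using h c xy by (simp add: translation_stabilizer_def)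
      also have "\<dots> \<longleftrightarrow> x \<otimes> y \<in> W" using g xy by (simp add: translation_stabilizer_def)
      finally show ?thesis .
    qed
    then show "g \<otimes> h \<in> translation_stabilizer W"
      using c by (simp add: translation_stabilizer_def)
  qed
next
  fix a g assume a: "a \<in> carrier G" and g: "g \<in> translation_stabilizer W"
  then have c: "g \<in> carrier G" by (simp add: translation_stabilizer_def)
  have "x \<otimes> (a \<otimes> g \<otimes> inv a) \<otimes> y \<in> W \<longleftrightarrow> x \<otimes> y \<in> W"
    if xy: "x \<in> carrier G" "y \<in> carrier G" for x y
  proof -
    have "x \<otimes> (a \<otimes> g \<otimes> inv a) \<otimes> y = (x \<otimes> a) \<otimes> g \<otimes> (inv a \<otimes> y)"
      using a c xy by (simp add: m_assoc)
    also have "\<dots> \<in> W \<longleftrightarrow> (x \<otimes> a) \<otimes> (inv a \<otimes> y) \<in> W"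
      using g a xy by (simp add: translation_stabilizer_def)
    also have "(x \<otimes> a) \<otimes> (inv a \<otimes> y) = x \<otimes> y"
      using a xy by (metis inv_closed m_assoc m_closed r_inv r_one)
    finally show ?thesis .
  qed
  then show "a \<otimes> g \<otimes> inv a \<in> translation_stabilizer W"
    using a c by (simp add: translation_stabilizer_def)
qed

text \<open>The complement of the stabilizer is the projection of a closed set along the compact space
  of all pairs \<open>(x, y)\<close>.\<close>

lemma openin_translation_stabilizer:
  assumes "compact_space T" "openin T W" "closedin T W"
  shows "openin T (translation_stabilizer W)"
proof -
  let ?X = "prod_topology (prod_topology T T) T"
  define A where "A = {z \<in> topspace ?X. fst (fst z) \<otimes> snd z \<otimes> snd (fst z) \<in> W}"
  define B where "B = {z \<in> topspace ?X. fst (fst z) \<otimes> snd (fst z) \<in> W}"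
  have c1: "continuous_map ?X T (\<lambda>z. fst (fst z))" and c2: "continuous_map ?X T (\<lambda>z. snd (fst z))"
    and c3: "continuous_map ?X T snd"
    using continuous_map_compose[OF continuous_map_fst continuous_map_fst]
      continuous_map_compose[OF continuous_map_fst continuous_map_snd]
    by (auto simp: comp_def continuous_map_snd)
  have A: "openin ?X A" "closedin ?X A" and B: "openin ?X B" "closedin ?X B"
    unfolding A_def B_def
    by (intro openin_continuous_map_preimage[where Y=T] closedin_continuous_map_preimage[where Y=T]
        continuous_map_mult c1 c2 c3 assms)+
  have "closedin ?X ((A - B) \<union> (B - A))"
    using A B by (intro closedin_Un closedin_diff)
  moreover have "closed_map ?X T snd"
    using assms(1) by (intro closed_map_snd) (simp add: compact_space_prod_topology)
  ultimately have "closedin T (snd ` ((A - B) \<union> (B - A)))"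
    by (simp add: closed_map_def)
  then have "openin T (topspace T - snd ` ((A - B) \<union> (B - A)))"
    by blast
  also have "topspace T - snd ` ((A - B) \<union> (B - A)) = translation_stabilizer W"
  proof -
    have AB: "((x, y), g) \<in> (A - B) \<union> (B - A) \<longleftrightarrow>
        x \<in> carrier G \<and> y \<in> carrier G \<and> g \<in> carrier G \<and>
        \<not> (x \<otimes> g \<otimes> y \<in> W \<longleftrightarrow> x \<otimes> y \<in> W)" for x y g
      unfolding A_def B_def by (auto simp: topspace_eq_carrier)
    have "g \<in> snd ` ((A - B) \<union> (B - A)) \<longleftrightarrow>
        (\<exists>x y. ((x, y), g) \<in> (A - B) \<union> (B - A))" for g
      unfolding image_iff Bex_def split_paired_Ex snd_conv by blast
    then show ?thesis
      unfolding AB translation_stabilizer_def topspace_eq_carrier by blast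
  qed
  finally show ?thesis .
qed

end

section \<open>Open normal subgroups of profinite groups\<close>

context profinite_group
begin

text \<open>In a compact Hausdorff space, components agree with quasi-components.\<close>

lemma clopen_separation:
  assumes "x \<in> topspace T" "y \<in> topspace T" "x \<noteq> y"
  obtains W where "openin T W" "closedin T W" "x \<in> W" "y \<notin> W"
proof -
  have "quasi_components_of T = connected_components_of T"
    using compact Hausdorff by (intro quasi_eq_connected_components_of) auto
  then have "quasi_component_of T x = connected_component_of T x"
    using assms(1) by (simp add: quasi_eq_connected_components_of_pointwise)
  then have "\<not> quasi_component_of T x y"
    using totally_disconnected[OF assms(1)] assms(3) by auto
  then obtain W where "x \<in> W" "closedin T W" "openin T W" "y \<notin> W"
    using assms(1,2) by (auto simp: quasi_component_of)
  then show thesis using that by blast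
qed

lemma open_normal_subgroup_in_neighbourhood:
  assumes "openin T V" "\<one> \<in> V"
  obtains U where "U \<lhd> G" "openin T U" "U \<subseteq> V"
proof -
  define \<W> where "\<W> = {W. openin T W \<and> closedin T W \<and> \<one> \<in> W}"
  have one: "\<one> \<in> topspace T" by (simp add: topspace_eq_carrier)
  have "\<Inter>(insert (topspace T - V) \<W>) = {}"
  proof -
    have "\<exists>W\<in>\<W>. x \<notin> W" if "x \<in> topspace T - V" for x
      using that assms(2) clopen_separation[OF one, of x] unfolding \<W>_def by blast
    then show ?thesis by blast
  qed
  moreover have "\<And>C. C \<in> insert (topspace T - V) \<W> \<Longrightarrow> closedin T C"
    using assms(1) by (auto simp: \<W>_def)
  ultimately obtain F where F: "finite F" "F \<subseteq> insert (topspace T - V) \<W>" "\<Inter>F = {}"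
    using compact unfolding compact_space_fip by meson
  \<comment> \<open>Compactness gives a single clopen neighbourhood \<open>W\<close> of the identity inside \<open>V\<close>.\<close>
  define W where "W = topspace T \<inter> \<Inter>(F - {topspace T - V})"
  have F': "\<And>C. C \<in> F - {topspace T - V} \<Longrightarrow> C \<in> \<W>" using F(2) by blast
  have "openin T W"
    unfolding W_def using F(1) F' by (intro openin_Int_Inter) (auto simp: \<W>_def)
  moreover have "closedin T W"
    unfolding W_def Inter_insert[symmetric] using F' by (intro closedin_Inter) (auto simp: \<W>_def)
  moreover have "\<one> \<in> W" using F' one unfolding W_def \<W>_def by blast
  ultimately have W: "openin T W" "closedin T W" "\<one> \<in> W" .
  have "W \<subseteq> V" using F(3) unfolding W_def by blast
  moreover have "translation_stabilizer W \<subseteq> W"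
  proof
    fix g assume "g \<in> translation_stabilizer W"
    then have "g \<in> carrier G" "\<one> \<otimes> g \<otimes> \<one> \<in> W \<longleftrightarrow> \<one> \<otimes> \<one> \<in> W"
      unfolding translation_stabilizer_def by blast+
    then show "g \<in> W" using W(3) by simp
  qed
  ultimately show thesis
    using that translation_stabilizer_normal openin_translation_stabilizer[OF compact W(1,2)] by blast
qed

text \<open>Since \<open>M\<close> is closed and proper, some open normal subgroup \<open>U\<close> satisfies \<open>U M \<noteq> G\<close>; then
  \<open>U M = M\<close> by maximality.\<close>

lemma maximal_closed_normal_subgroup_open:
  assumes "maximal_closed_normal_subgroup M G T"
  shows "openin T M"
proof -
  have M: "M \<lhd> G" "closedin T M" "M \<noteq> carrier G"
    and max: "\<And>L. \<lbrakk>L \<lhd> G; closedin T L; M \<subseteq> L\<rbrakk> \<Longrightarrow> L = M \<or> L = carrier G"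
    using assms by (auto simp: maximal_closed_normal_subgroup_def closed_normal_subgroup_def)
  note Msub = normal_imp_subgroup[OF M(1)]
  obtain g where g: "g \<in> carrier G" "g \<notin> M"
    using M(3) subgroup.subset[OF Msub] by blast
  have "openin T {w \<in> topspace T. inv w \<otimes> g \<in> topspace T - M}"
    using M(2) g(1)
    by (intro openin_continuous_map_preimage[where Y=T] continuous_map_mult continuous_inv)
       (auto simp: topspace_eq_carrier[symmetric])
  moreover have "\<one> \<in> {w \<in> topspace T. inv w \<otimes> g \<in> topspace T - M}"
    using g by (simp add: topspace_eq_carrier)
  ultimately obtain U where U: "U \<lhd> G" "openin T U"
      "U \<subseteq> {w \<in> topspace T. inv w \<otimes> g \<in> topspace T - M}"
    using open_normal_subgroup_in_neighbourhood by blast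
  note Usub = normal_imp_subgroup[OF U(1)]
  have UM: "U <#> M \<lhd> G" using U(1) M(1) normal_subgroup_set_mult_closed by blast
  have "U \<subseteq> U <#> M" "M \<subseteq> U <#> M"
    using subset_set_mult_left[OF Usub Msub] subset_set_mult_right[OF Usub Msub] .
  have "closedin T (U <#> M)"
    using open_subgroup_closed[OF Usub U(2)] M(2) compact Hausdorff by (intro closedin_set_mult)
  moreover have "g \<notin> U <#> M"
  proof
    assume "g \<in> U <#> M"
    then obtain u m where um: "u \<in> U" "m \<in> M" "g = u \<otimes> m" by (auto simp: set_mult_def)
    then have "inv u \<otimes> g = m"
      using subgroup.subset[OF Usub] subgroup.subset[OF Msub]
      by (metis inv_solve_left m_closed subsetD)
    then show False using U(3) um by blast
  qed
  ultimately have "U <#> M = M" using max[OF UM] \<open>M \<subseteq> U <#> M\<close> g(1) by blast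
  then have "U \<subseteq> M" using \<open>U \<subseteq> U <#> M\<close> by simp
  then show ?thesis using subgroup_containing_open_subgroup_open[OF Usub U(2) Msub] by blast
qed

end

section \<open>The normal Frattini subgroup of a closed normal subgroup\<close>

lemma normal_frattini_subgroup:
  assumes "group G"
  shows "subgroup (normal_frattini G T) G"
proof (rule group.subgroupI[OF assms])
  interpret group G by fact
  have sub: "subgroup N G" if "maximal_closed_normal_subgroup N G T" for N
    using that normal_imp_subgroup
    by (auto simp: maximal_closed_normal_subgroup_def closed_normal_subgroup_def)
  show "normal_frattini G T \<subseteq> carrier G" by (auto simp: normal_frattini_def)
  have "\<one>\<^bsub>G\<^esub> \<in> normal_frattini G T"
    using subgroup.one_closed[OF sub] by (auto simp: normal_frattini_def)
  then show "normal_frattini G T \<noteq> {}" by blast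
  show "inv\<^bsub>G\<^esub> a \<in> normal_frattini G T" if "a \<in> normal_frattini G T" for a
    using that subgroup.m_inv_closed[OF sub] by (auto simp: normal_frattini_def)
  show "a \<otimes>\<^bsub>G\<^esub> b \<in> normal_frattini G T"
    if "a \<in> normal_frattini G T" "b \<in> normal_frattini G T" for a b
    using that subgroup.m_closed[OF sub] by (auto simp: normal_frattini_def)
qed

lemma normal_frattini_closedin:
  assumes "topspace T = carrier G"
  shows "closedin T (normal_frattini G T)"
proof -
  have "normal_frattini G T =
      \<Inter>(insert (topspace T) {N. maximal_closed_normal_subgroup N G T})"
    using assms by (auto simp: normal_frattini_def)
  also have "closedin T \<dots>"
    by (rule closedin_Inter)
       (auto simp: maximal_closed_normal_subgroup_def closed_normal_subgroup_def)
  finally show ?thesis .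
qed

context topological_group
begin

lemma maximal_closed_normal_subgroup_join:
  assumes "compact_space T" "Hausdorff_space T"
    and M: "maximal_closed_normal_subgroup M G T"
    and K: "closed_normal_subgroup K G T" and "\<not> K \<subseteq> M"
  shows "M <#> K = carrier G"
proof -
  have Mn: "M \<lhd> G" and Kn: "K \<lhd> G"
    using M K by (auto simp: maximal_closed_normal_subgroup_def closed_normal_subgroup_def)
  note Ms = normal_imp_subgroup[OF Mn] and Ks = normal_imp_subgroup[OF Kn]
  have "closed_normal_subgroup (M <#> K) G T"
    using M K assms(1,2) normal_subgroup_set_mult_closed[OF Mn Kn]
    by (auto simp: maximal_closed_normal_subgroup_def closed_normal_subgroup_def
        intro!: closedin_set_mult)
  moreover have "M \<subseteq> M <#> K" "K \<subseteq> M <#> K"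
    using subset_set_mult_left[OF Ms Ks] subset_set_mult_right[OF Ms Ks] .
  ultimately show ?thesis
    using M assms(5) unfolding maximal_closed_normal_subgroup_def by metis
qed

lemma maximal_closed_normal_subgroup_Int:
  assumes comp: "compact_space T" and haus: "Hausdorff_space T"
    and M: "maximal_closed_normal_subgroup M G T"
    and H: "closed_normal_subgroup H G T" and HM: "\<not> H \<subseteq> M"
  shows "maximal_closed_normal_subgroup (M \<inter> H) (G\<lparr>carrier := H\<rparr>) (subtopology T H)"
proof -
  have Mn: "M \<lhd> G" and Mc: "closedin T M" and Hn: "H \<lhd> G" and Hc: "closedin T H"
    using M H by (auto simp: maximal_closed_normal_subgroup_def closed_normal_subgroup_def)
  note Ms = normal_imp_subgroup[OF Mn] and Hs = normal_imp_subgroup[OF Hn]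
  interpret M: subgroup M G by fact
  interpret H: subgroup H G by fact
  have MH: "M <#> H = carrier G"
    using maximal_closed_normal_subgroup_join[OF comp haus M H HM] .
  have "N = M \<inter> H \<or> N = H"
    if N: "N \<lhd> G\<lparr>carrier := H\<rparr>" "closedin (subtopology T H) N" and MN: "M \<inter> H \<subseteq> N" for N
  proof -
    interpret N: normal N "G\<lparr>carrier := H\<rparr>" by fact
    have NH: "N \<subseteq> H" using N.subset by simp
    have Ns: "subgroup N G" using incl_subgroup[OF Hs N.subgroup_axioms] .
    have Nc: "closedin T N" using N(2) Hc closedin_trans_full by blast
    have "M <#> N \<lhd> G" by (rule normal_set_mult_of_normal_in_factor[OF Mn Hs N(1) MH])
    moreover have "closedin T (M <#> N)" using comp haus Mc Nc by (rule closedin_set_mult)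
    moreover have "M \<subseteq> M <#> N" using subset_set_mult_left[OF Ms Ns] .
    ultimately have "M <#> N = M \<or> M <#> N = carrier G"
      using M unfolding maximal_closed_normal_subgroup_def closed_normal_subgroup_def by metis
    then show ?thesis
    proof
      assume "M <#> N = M"
      moreover have "N \<subseteq> M <#> N" using subset_set_mult_right[OF Ms Ns] .
      ultimately show ?thesis using NH MN by blast
    next
      assume eq: "M <#> N = carrier G"
      have "H \<subseteq> N"
      proof
        fix h assume h: "h \<in> H"
        then have "h \<in> M <#> N" using eq H.subset by blast
        then obtain m n where mn: "m \<in> M" "n \<in> N" "h = m \<otimes> n"
          by (auto simp: set_mult_def)
        have nH: "n \<in> H" using mn(2) NH by blast
        have "m = h \<otimes> inv n"
          using mn nH M.mem_carrier H.mem_carrier by (simp add: m_assoc)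
        then have "m \<in> H" using h nH by simp
        then have "m \<in> N" using mn(1) MN by blast
        then show "h \<in> N" using mn subgroup.m_closed[OF Ns] by simp
      qed
      then show ?thesis using NH by blast
    qed
  qed
  moreover have "M \<inter> H \<lhd> G\<lparr>carrier := H\<rparr>" using normal_Int_subgroup[OF Hs Mn] .
  moreover have "closedin (subtopology T H) (M \<inter> H)"
    using Mc by (auto simp: closedin_subtopology)
  ultimately show ?thesis
    using HM unfolding maximal_closed_normal_subgroup_def closed_normal_subgroup_def
    by (simp add: inf.absorb_iff2[symmetric])
qed

lemma normal_frattini_mono:
  assumes "compact_space T" "Hausdorff_space T" "closed_normal_subgroup H G T"
  shows "normal_frattini (G\<lparr>carrier := H\<rparr>) (subtopology T H) \<subseteq> normal_frattini G T"
proof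
  fix x assume x: "x \<in> normal_frattini (G\<lparr>carrier := H\<rparr>) (subtopology T H)"
  then have xH: "x \<in> H" by (simp add: normal_frattini_def)
  moreover have "H \<subseteq> carrier G"
    using assms(3) subgroup.subset[of H G] normal_imp_subgroup[of H G]
    by (simp add: closed_normal_subgroup_def)
  moreover have "x \<in> M" if M: "maximal_closed_normal_subgroup M G T" for M
  proof (cases "H \<subseteq> M")
    case False
    then have "maximal_closed_normal_subgroup (M \<inter> H) (G\<lparr>carrier := H\<rparr>) (subtopology T H)"
      by (rule maximal_closed_normal_subgroup_Int[OF assms(1,2) M assms(3)])
    then have "x \<in> M \<inter> H" using x unfolding normal_frattini_def by blast
    then show ?thesis by blast
  qed (use xH in blast)
  ultimately show "x \<in> normal_frattini G T" by (auto simp: normal_frattini_def)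
qed

lemma normal_frattini_closed_subgroup:
  assumes "compact_space T" "Hausdorff_space T" "closed_normal_subgroup H G T"
  shows "closed_subgroup (normal_frattini (G\<lparr>carrier := H\<rparr>) (subtopology T H))
    (G\<lparr>carrier := normal_frattini G T\<rparr>) (subtopology T (normal_frattini G T))"
proof -
  let ?F = "normal_frattini G T" and ?FH = "normal_frattini (G\<lparr>carrier := H\<rparr>) (subtopology T H)"
  have H: "subgroup H G" "closedin T H"
    using assms(3) normal_imp_subgroup by (auto simp: closed_normal_subgroup_def)
  have "subgroup ?FH (G\<lparr>carrier := H\<rparr>)"
    using subgroup_imp_group[OF H(1)] by (rule normal_frattini_subgroup)
  then have "subgroup ?FH G" using incl_subgroup[OF H(1)] by blast
  then have "subgroup ?FH (G\<lparr>carrier := ?F\<rparr>)"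
    using subgroup_incl normal_frattini_subgroup[OF is_group] normal_frattini_mono[OF assms] by blast
  moreover have "closedin (subtopology T H) ?FH"
    using closedin_subset[OF H(2)]
    by (intro normal_frattini_closedin) (simp add: Int_absorb1)
  then have "closedin T ?FH" using H(2) closedin_trans_full by blast
  then have "closedin (subtopology T ?F) ?FH"
    using normal_frattini_mono[OF assms] by (metis closedin_subset_topspace)
  ultimately show ?thesis by (simp add: closed_subgroup_def)
qed

end

section \<open>Decomposition into a product of simple quotients\<close>

context topological_group
begin

text \<open>A normal subgroup of \<open>G / M\<close> has a preimage that contains the open subgroup \<open>M\<close>, and
  therefore is closed automatically.\<close>

lemma maximal_open_normal_quotient_simple:
  assumes comp: "compact_space T"
    and M: "maximal_closed_normal_subgroup M G T" and op: "openin T M"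
  shows "simple_group (G Mod M)"
proof -
  have Mn: "M \<lhd> G" and MG: "M \<noteq> carrier G"
    and max: "\<And>L. \<lbrakk>L \<lhd> G; closedin T L; M \<subseteq> L\<rbrakk> \<Longrightarrow> L = M \<or> L = carrier G"
    using M by (auto simp: maximal_closed_normal_subgroup_def closed_normal_subgroup_def)
  interpret M: normal M G by fact
  interpret Q: group "G Mod M" by (rule M.factorgroup_is_group)
  have fin: "finite (rcosets M)"
    using open_subgroup_finite_index[OF comp M.subgroup_axioms op] .
  show ?thesis
  proof
    obtain g where g: "g \<in> carrier G" "g \<notin> M" using MG M.subset by blast
    have "M \<in> rcosets M" using M.subgroup_in_rcosets[OF is_group] .
    moreover have "M #> g \<in> rcosets M" using g(1) M.subset rcosetsI by blast
    moreover have "M #> g \<noteq> M" using g rcos_self[OF g(1) M.subgroup_axioms] by blast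
    ultimately have "card {M, M #> g} \<le> card (rcosets M)" using fin by (intro card_mono) auto
    then show "1 < order (G Mod M)"
      using \<open>M #> g \<noteq> M\<close> by (simp add: order_def FactGroup_def)
  next
    fix A assume A: "A \<lhd> G Mod M"
    interpret A: normal A "G Mod M" by fact
    have UA: "\<Union>A = {x \<in> carrier G. M #> x \<in> A}"
      using M.factgroup_subgroup_union_char[OF A.subgroup_axioms] .
    have UAn: "\<Union>A \<lhd> G" using M.factgroup_subgroup_union_normal[OF A] .
    have "M \<in> A" using A.one_closed by simp
    then have MU: "M \<subseteq> \<Union>A" by blast
    have "openin T (\<Union>A)"
      using subgroup_containing_open_subgroup_open[OF M.subgroup_axioms op normal_imp_subgroup[OF UAn] MU] .
    then have "closedin T (\<Union>A)" using open_subgroup_closed normal_imp_subgroup[OF UAn] by blast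
    then have "\<Union>A = M \<or> \<Union>A = carrier G" using max UAn MU by blast
    then show "A = carrier (G Mod M) \<or> A = {\<one>\<^bsub>G Mod M\<^esub>}"
    proof
      assume eq: "\<Union>A = M"
      have "C = M" if C: "C \<in> A" for C
      proof -
        obtain x where x: "x \<in> carrier G" "C = M #> x"
          using C A.subset by (auto simp: carrier_FactGroup)
        then have "x \<in> M" using C UA eq by blast
        then show ?thesis using x M.rcos_const[OF is_group] by simp
      qed
      then have "A = {M}" using \<open>M \<in> A\<close> by blast
      then show ?thesis by simp
    next
      assume eq: "\<Union>A = carrier G"
      then have "carrier (G Mod M) \<subseteq> A" using UA by (auto simp: carrier_FactGroup)
      then show ?thesis using A.subset by blast
    qed
  qed
qed

text \<open>Independence of a set \<open>I\<close> of subgroups: for each finite \<open>F \<subseteq> I\<close>, any choice of cosets of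
  the members of \<open>F\<close> has a common element, that is, \<open>G\<close> maps onto the product of the \<open>G / N\<close> over
  \<open>N \<in> F\<close>.  The cosets are given by representatives \<open>x N\<close>.  Testing only finite subsets makes the
  property pass to unions of chains.\<close>

definition jointly_surjective :: "'a set set \<Rightarrow> bool"
  where "jointly_surjective I \<longleftrightarrow>
    (\<forall>F x. finite F \<and> F \<subseteq> I \<and> x \<in> F \<rightarrow> carrier G \<longrightarrow>
       (\<exists>g\<in>carrier G. \<forall>N\<in>F. g \<in> N #> x N))"

text \<open>A common element of cosets of members of \<open>I\<close> may be multiplied by any \<open>k\<close> in the intersection
  of \<open>I\<close>; as \<open>M\<close> and this intersection generate \<open>G\<close>, a suitable \<open>k\<close> moves it into the prescribed
  coset of \<open>M\<close>.\<close>

lemma jointly_surjective_insert: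
  assumes I: "jointly_surjective I" "\<And>N. N \<in> I \<Longrightarrow> subgroup N G"
    and M: "M \<lhd> G" and MK: "M <#> (carrier G \<inter> \<Inter>I) = carrier G"
  shows "jointly_surjective (insert M I)"
  unfolding jointly_surjective_def
proof (intro allI impI)
  fix F x assume F: "finite F \<and> F \<subseteq> insert M I \<and> x \<in> F \<rightarrow> carrier G"
  interpret M: normal M G by fact
  have "finite (F - {M})" using F by simp
  moreover have "F - {M} \<subseteq> I" using F by blast
  moreover have "x \<in> F - {M} \<rightarrow> carrier G" using F by (simp add: Pi_iff)
  ultimately have "\<exists>g\<in>carrier G. \<forall>N\<in>F - {M}. g \<in> N #> x N"
    using I(1)[unfolded jointly_surjective_def, rule_format, of "F - {M}" x] by simp
  then obtain g where g: "g \<in> carrier G" "\<And>N. N \<in> F - {M} \<Longrightarrow> g \<in> N #> x N"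
    by blast
  show "\<exists>g\<in>carrier G. \<forall>N\<in>F. g \<in> N #> x N"
  proof (cases "M \<in> F")
    case False
    then show ?thesis using g by blast
  next
    case True
    then have xM: "x M \<in> carrier G" using F by blast
    then have "x M \<otimes> inv g \<in> M <#> (carrier G \<inter> \<Inter>I)" using g(1) MK by simp
    then obtain m k where m: "m \<in> M" and k: "k \<in> carrier G \<inter> \<Inter>I"
      and eq: "x M \<otimes> inv g = m \<otimes> k"
      unfolding set_mult_def by blast
    have mk: "m \<in> M" "k \<in> carrier G" "\<And>N. N \<in> I \<Longrightarrow> k \<in> N"
      using m k by blast+
    have mc: "m \<in> carrier G" using mk(1) M.subset by blast
    have "m \<otimes> (k \<otimes> g) = x M \<otimes> inv g \<otimes> g"
      unfolding eq using mc mk(2) g(1) by (simp add: m_assoc)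
    also have "\<dots> = x M" using xM g(1) by (simp add: m_assoc)
    finally have "x M = m \<otimes> (k \<otimes> g)" by simp
    then have "k \<otimes> g = inv m \<otimes> x M"
      using inv_solve_left[of "k \<otimes> g" m "x M"] mc mk(2) g(1) xM by simp
    then have "k \<otimes> g \<in> M #> x M"
      using M.m_inv_closed[OF mk(1)] unfolding r_coset_def by blast
    moreover have "k \<otimes> g \<in> N #> x N" if N: "N \<in> F - {M}" for N
    proof -
      have NI: "N \<in> I" using N F by blast
      have xN: "x N \<in> carrier G" using N F by blast
      obtain n where n: "n \<in> N" "g = n \<otimes> x N" using g(2)[OF N] by (auto simp: r_coset_def)
      have nc: "n \<in> carrier G" using n(1) subgroup.mem_carrier[OF I(2)[OF NI]] by blast
      have "k \<otimes> g = (k \<otimes> n) \<otimes> x N" using n(2) nc mk(2) xN by (simp add: m_assoc)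
      moreover have "k \<otimes> n \<in> N" using mk(3)[OF NI] n(1) subgroup.m_closed[OF I(2)[OF NI]] by blast
      ultimately show ?thesis unfolding r_coset_def by blast
    qed
    ultimately show ?thesis using g(1) mk(2) by blast
  qed
qed

lemma jointly_surjective_Union_chain:
  assumes "subset.chain \<A> \<C>" "\<C> \<noteq> {}" "\<And>I. I \<in> \<C> \<Longrightarrow> jointly_surjective I"
  shows "jointly_surjective (\<Union>\<C>)"
  unfolding jointly_surjective_def
proof (intro allI impI)
  fix F x assume F: "finite F \<and> F \<subseteq> \<Union>\<C> \<and> x \<in> F \<rightarrow> carrier G"
  then obtain I where "I \<in> \<C>" "F \<subseteq> I"
    using finite_subset_Union_chain[of F \<C> \<A>] assms(1,2) by blast
  then show "\<exists>g\<in>carrier G. \<forall>N\<in>F. g \<in> N #> x N"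
    using F assms(3) unfolding jointly_surjective_def by blast
qed

text \<open>By compactness, the coset condition extends from finite subsets to the whole of \<open>I\<close>.\<close>

lemma jointly_surjective_simultaneous:
  assumes comp: "compact_space T" and I: "jointly_surjective I"
    and N: "\<And>N. N \<in> I \<Longrightarrow> subgroup N G \<and> closedin T N"
    and x: "\<And>N. N \<in> I \<Longrightarrow> x N \<in> carrier G"
  shows "\<exists>g\<in>carrier G. \<forall>N\<in>I. g \<in> N #> x N"
proof (cases "I = {}")
  case True
  then show ?thesis by auto
next
  case False
  have cl: "closedin T (N #> x N)" if "N \<in> I" for N
    using that N x closedin_r_coset by blast
  have "\<Inter>\<F> \<noteq> {}" if \<F>: "finite \<F>" "\<F> \<subseteq> (\<lambda>N. N #> x N) ` I" for \<F>
  proof -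
    obtain F where F: "F \<subseteq> I" "finite F" "\<F> = (\<lambda>N. N #> x N) ` F"
      using finite_subset_image[OF \<F>] by blast
    then have "x \<in> F \<rightarrow> carrier G" using x by blast
    then obtain g where "\<forall>N\<in>F. g \<in> N #> x N"
      using I F(1,2) unfolding jointly_surjective_def by blast
    then show ?thesis using F(3) by blast
  qed
  moreover have "\<forall>C\<in>(\<lambda>N. N #> x N) ` I. closedin T C" using cl by blast
  ultimately have "\<Inter>((\<lambda>N. N #> x N) ` I) \<noteq> {}"
    using comp[unfolded compact_space_fip, rule_format, of "(\<lambda>N. N #> x N) ` I"] by simp
  then obtain g where g: "\<And>N. N \<in> I \<Longrightarrow> g \<in> N #> x N" by blast
  moreover have "g \<in> carrier G"
    using False g closedin_subset[OF cl] unfolding topspace_eq_carrier by blast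
  ultimately show ?thesis by blast
qed

lemma continuous_map_open_subgroup_quotient:
  assumes "subgroup N G" "openin T N"
  shows "continuous_map T (discrete_topology (rcosets N)) (\<lambda>x. N #> x)"
  unfolding continuous_map_def
proof (intro conjI allI impI)
  show "(\<lambda>x. N #> x) \<in> topspace T \<rightarrow> topspace (discrete_topology (rcosets N))"
    by (auto simp: topspace_eq_carrier RCOSETS_def)
  fix C assume "openin (discrete_topology (rcosets N)) C"
  then have C: "C \<subseteq> rcosets N" by simp
  have "{x \<in> topspace T. N #> x \<in> C} = \<Union>C"
  proof (intro equalityI subsetI)
    fix x assume "x \<in> {x \<in> topspace T. N #> x \<in> C}"
    then show "x \<in> \<Union>C" using rcos_self[OF _ assms(1), of x] by (auto simp: topspace_eq_carrier)
  next
    fix x assume "x \<in> \<Union>C"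
    then obtain D where D: "D \<in> C" "x \<in> D" by blast
    then obtain y where y: "y \<in> carrier G" "D = N #> y" using C by (auto simp: RCOSETS_def)
    then have "D = N #> x" "x \<in> carrier G"
      using D(2) repr_independence[OF _ y(1) assms(1)] subgroup.elemrcos_carrier[OF assms(1) is_group] by auto
    then show "x \<in> {x \<in> topspace T. N #> x \<in> C}" using D(1) by (simp add: topspace_eq_carrier)
  qed
  then show "openin T {x \<in> topspace T. N #> x \<in> C}"
    using openin_union_cosets[OF assms C] by simp
qed

lemma topological_group_iso_product_quotients:
  assumes comp: "compact_space T"
    and I: "jointly_surjective I" and N: "\<And>N. N \<in> I \<Longrightarrow> N \<lhd> G \<and> openin T N"
    and triv: "carrier G \<inter> \<Inter>I \<subseteq> {\<one>}"
  shows "topological_group_iso (\<lambda>x. \<lambda>N\<in>I. N #> x) G T (product_group I (\<lambda>N. G Mod N))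
    (product_topology (\<lambda>N. discrete_topology (carrier (G Mod N))) I)"
proof -
  let ?f = "\<lambda>x. \<lambda>N\<in>I. N #> x"
  have Ns: "subgroup N G" "openin T N" "closedin T N" if "N \<in> I" for N
    using N[OF that] normal_imp_subgroup open_subgroup_closed by blast+
  have inj: "inj_on ?f (carrier G)"
  proof (rule inj_onI)
    fix x y assume xy: "x \<in> carrier G" "y \<in> carrier G" "?f x = ?f y"
    have "x \<otimes> inv y \<in> N" if NI: "N \<in> I" for N
    proof -
      have "N #> x = N #> y" using fun_cong[OF xy(3), of N] NI by simp
      then have "x \<in> N #> y" using rcos_self[OF xy(1) Ns(1)[OF NI]] by simp
      then show ?thesis using subgroup.rcos_module_imp[OF Ns(1)[OF NI] is_group xy(2)] by blast
    qed
    then have "x \<otimes> inv y \<in> carrier G \<inter> \<Inter>I" using xy(1,2) by simp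
    then have "x \<otimes> inv y = \<one>" using triv by blast
    then show "x = y" using xy(1,2) inv_equality[of x "inv y"] by simp
  qed
  have surj: "?f ` carrier G = (\<Pi>\<^sub>E N\<in>I. carrier (G Mod N))"
  proof
    show "?f ` carrier G \<subseteq> (\<Pi>\<^sub>E N\<in>I. carrier (G Mod N))" by (auto simp: carrier_FactGroup)
    show "(\<Pi>\<^sub>E N\<in>I. carrier (G Mod N)) \<subseteq> ?f ` carrier G"
    proof
      fix y assume y: "y \<in> (\<Pi>\<^sub>E N\<in>I. carrier (G Mod N))"
      then have "\<forall>N\<in>I. \<exists>x\<in>carrier G. y N = N #> x" by (auto simp: carrier_FactGroup)
      then obtain x where x: "\<And>N. N \<in> I \<Longrightarrow> x N \<in> carrier G" "\<And>N. N \<in> I \<Longrightarrow> y N = N #> x N"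
        by metis
      have "\<exists>g\<in>carrier G. \<forall>N\<in>I. g \<in> N #> x N"
        by (rule jointly_surjective_simultaneous[OF comp I]) (use Ns x(1) in simp_all)
      then obtain g where g: "g \<in> carrier G" "\<And>N. N \<in> I \<Longrightarrow> g \<in> N #> x N" by blast
      have "y = ?f g"
      proof
        fix N show "y N = ?f g N"
        proof (cases "N \<in> I")
          case True
          then show ?thesis
            using repr_independence[OF g(2)[OF True] x(1)[OF True] Ns(1)[OF True]] x(2)[OF True]
            by simp
        next
          case False
          then show ?thesis using PiE_arb[OF y] by simp
        qed
      qed
      then show "y \<in> ?f ` carrier G" using g(1) by blast
    qed
  qed
  have "?f \<in> hom G (product_group I (\<lambda>N. G Mod N))"
  proof (rule homI)
    show "?f x \<in> carrier (product_group I (\<lambda>N. G Mod N))" if "x \<in> carrier G" for x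
      using that by (simp add: carrier_FactGroup)
    show "?f (x \<otimes> y) = ?f x \<otimes>\<^bsub>product_group I (\<lambda>N. G Mod N)\<^esub> ?f y"
      if "x \<in> carrier G" "y \<in> carrier G" for x y
      using normal.rcos_sum[OF conjunct1[OF N] that]
      by (simp add: restrict_def fun_eq_iff)
  qed
  then have "?f \<in> iso G (product_group I (\<lambda>N. G Mod N))"
    using inj surj by (simp add: iso_def bij_betw_def)
  moreover have "homeomorphic_map T
      (product_topology (\<lambda>N. discrete_topology (carrier (G Mod N))) I) ?f"
  proof (rule continuous_imp_homeomorphic_map)
    show "continuous_map T (product_topology (\<lambda>N. discrete_topology (carrier (G Mod N))) I) ?f"
      using continuous_map_open_subgroup_quotient[OF Ns(1,2)]
      by (simp add: continuous_map_componentwise FactGroup_def image_subset_iff)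
    show "Hausdorff_space (product_topology (\<lambda>N. discrete_topology (carrier (G Mod N))) I)"
      by (simp add: Hausdorff_space_product_topology)
    show "?f ` topspace T = topspace (product_topology (\<lambda>N. discrete_topology (carrier (G Mod N))) I)"
      using surj by (simp add: topspace_eq_carrier)
    show "inj_on ?f (topspace T)" using inj by (simp add: topspace_eq_carrier)
  qed (fact comp)
  ultimately show ?thesis by (simp add: topological_group_iso_def)
qed

lemma finite_radical_dense:
  assumes comp: "compact_space T"
    and I: "jointly_surjective I" and N: "\<And>N. N \<in> I \<Longrightarrow> N \<lhd> G \<and> openin T N"
    and triv: "carrier G \<inter> \<Inter>I \<subseteq> {\<one>}"
  shows "T closure_of finite_radical G = carrier G"
proof -
  have Ns: "subgroup N G" "openin T N" "closedin T N" if "N \<in> I" for N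
    using N[OF that] normal_imp_subgroup open_subgroup_closed by blast+
  have fin: "carrier G \<inter> \<Inter>(I - F) \<subseteq> finite_radical G" if F: "finite F" "F \<subseteq> I" for F
  proof -
    let ?K = "carrier G \<inter> \<Inter>(I - F)"
    have "?K \<lhd> G" using N by (intro normal_Inter) blast
    moreover have "finite ?K"
    proof (rule inj_on_finite)
      show "finite (\<Pi>\<^sub>E N\<in>F. rcosets N)"
        using F open_subgroup_finite_index[OF comp Ns(1,2)] by (intro finite_PiE) auto
      show "(\<lambda>x. \<lambda>N\<in>F. N #> x) ` ?K \<subseteq> (\<Pi>\<^sub>E N\<in>F. rcosets N)"
        by (auto simp: RCOSETS_def)
      show "inj_on (\<lambda>x. \<lambda>N\<in>F. N #> x) ?K"
      proof (rule inj_onI)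
        fix x y assume x: "x \<in> ?K" and y: "y \<in> ?K"
          and eq: "(\<lambda>N\<in>F. N #> x) = (\<lambda>N\<in>F. N #> y)"
        have c: "x \<in> carrier G" "y \<in> carrier G" using x y by auto
        have "x \<otimes> inv y \<in> N" if NI: "N \<in> I" for N
        proof (cases "N \<in> F")
          case True
          then have "N #> x = N #> y" using fun_cong[OF eq, of N] by simp
          then have "x \<in> N #> y" using rcos_self[OF c(1) Ns(1)[OF NI]] by simp
          then show ?thesis using subgroup.rcos_module_imp[OF Ns(1)[OF NI] is_group c(2)] by blast
        next
          case False
          then have "x \<in> N" "y \<in> N" using x y NI by auto
          then show ?thesis using subgroup.m_closed[OF Ns(1)[OF NI]] subgroup.m_inv_closed[OF Ns(1)[OF NI]] by blast
        qed
        then have "x \<otimes> inv y \<in> carrier G \<inter> \<Inter>I" using c by simp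
        then have "x \<otimes> inv y = \<one>" using triv by blast
        then show "x = y" using c inv_equality[of x "inv y"] by simp
      qed
    qed
    ultimately show ?thesis unfolding finite_radical_def by blast
  qed
  have "\<exists>h\<in>finite_radical G. h \<in> V" if g: "g \<in> carrier G" and V: "openin T V" "g \<in> V" for g V
  proof -
    have "\<Inter>(insert (topspace T - V) ((\<lambda>N. N #> g) ` I)) = {}"
    proof -
      have "y = g" if y: "y \<in> topspace T" "\<And>N. N \<in> I \<Longrightarrow> y \<in> N #> g" for y
      proof -
        have "y \<otimes> inv g \<in> N" if "N \<in> I" for N
          using subgroup.rcos_module_imp[OF Ns(1)[OF that] is_group g] y(2)[OF that] by blast
        moreover have yc: "y \<in> carrier G" using y(1) topspace_eq_carrier by simp
        ultimately have "y \<otimes> inv g \<in> carrier G \<inter> \<Inter>I" using g by simp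
        then have "y \<otimes> inv g = \<one>" using triv by blast
        then show ?thesis using yc g inv_equality[of y "inv g"] by simp
      qed
      then show ?thesis using V(2) by blast
    qed
    moreover have "\<forall>C\<in>insert (topspace T - V) ((\<lambda>N. N #> g) ` I). closedin T C"
      using V(1) closedin_r_coset[OF Ns(1,3) g] by blast
    ultimately obtain \<F> where \<F>: "finite \<F>"
        "\<F> \<subseteq> insert (topspace T - V) ((\<lambda>N. N #> g) ` I)" "\<Inter>\<F> = {}"
      using comp unfolding compact_space_fip by meson
    have "finite (\<F> - {topspace T - V})" "\<F> - {topspace T - V} \<subseteq> (\<lambda>N. N #> g) ` I"
      using \<F>(1,2) by auto
    from finite_subset_image[OF this]
    obtain F where F: "F \<subseteq> I" "finite F" "\<F> - {topspace T - V} = (\<lambda>N. N #> g) ` F"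
      by (elim exE conjE) (rule that)
    \<comment> \<open>By compactness, finitely many cosets \<open>N g\<close>, \<open>N \<in> F\<close>, already intersect inside \<open>V\<close>.  Choosing
      \<open>h\<close> in these and in every \<open>N \<in> I - F\<close> puts it in \<open>V\<close> and in the finite radical.\<close>
    let ?x = "\<lambda>N. if N \<in> F then g else \<one>"
    have "\<exists>h\<in>carrier G. \<forall>N\<in>I. h \<in> N #> ?x N"
      by (rule jointly_surjective_simultaneous[OF comp I]) (use Ns g in simp_all)
    then obtain h where h: "h \<in> carrier G" "\<And>N. N \<in> I \<Longrightarrow> h \<in> N #> ?x N" by blast
    have "h \<in> V"
    proof (rule ccontr)
      assume "h \<notin> V"
      then have "h \<in> topspace T - V" using h(1) topspace_eq_carrier by simp
      moreover have "h \<in> C" if C: "C \<in> \<F> - {topspace T - V}" for C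
      proof -
        obtain N where N: "N \<in> F" "C = N #> g" using C F(3) by blast
        then have "N \<in> I" using F(1) by blast
        then show ?thesis using h(2)[of N] N by simp
      qed
      ultimately show False using \<F>(3) by blast
    qed
    moreover have "h \<in> N" if "N \<in> I - F" for N
    proof -
      have "N \<in> I" "N \<notin> F" using that by blast+
      then show ?thesis using h(2)[of N] coset_mult_one subgroup.subset[OF Ns(1)] by simp
    qed
    then have "h \<in> finite_radical G" using fin[OF F(2,1)] h(1) by blast
    ultimately show ?thesis by blast
  qed
  then show ?thesis
    by (simp add: set_eq_iff in_closure_of topspace_eq_carrier Bex_def) blast
qed

end

context profinite_group
begin

lemma exists_jointly_surjective_trivial_Inter:
  assumes "normal_frattini G T = {\<one>}"
  shows "\<exists>I. jointly_surjective I \<and> (\<forall>N\<in>I. maximal_closed_normal_subgroup N G T) \<and>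
    carrier G \<inter> \<Inter>I \<subseteq> {\<one>}"
proof -
  let ?\<A> = "{I. jointly_surjective I \<and> (\<forall>N\<in>I. maximal_closed_normal_subgroup N G T)}"
  have "\<exists>I\<in>?\<A>. \<forall>J\<in>?\<A>. I \<subseteq> J \<longrightarrow> J = I"
  proof (rule subset_Zorn_nonempty)
    have "{} \<in> ?\<A>" by (auto simp: jointly_surjective_def)
    then show "?\<A> \<noteq> {}" by blast
  next
    fix \<C> assume \<C>: "\<C> \<noteq> {}" "subset.chain ?\<A> \<C>"
    then have "\<C> \<subseteq> ?\<A>" by (simp add: subset_chain_def)
    then show "\<Union>\<C> \<in> ?\<A>"
      using jointly_surjective_Union_chain[OF \<C>(2,1)] by blast
  qed
  then obtain I where IA: "I \<in> ?\<A>" and max: "\<forall>J\<in>?\<A>. I \<subseteq> J \<longrightarrow> J = I"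
    by (rule bexE)
  have I: "jointly_surjective I" "\<And>N. N \<in> I \<Longrightarrow> maximal_closed_normal_subgroup N G T"
    using IA by simp_all
  have In: "N \<lhd> G" "closedin T N" if "N \<in> I" for N
    using I(2)[OF that] by (auto simp: maximal_closed_normal_subgroup_def closed_normal_subgroup_def)
  let ?K = "carrier G \<inter> \<Inter>I"
  have K: "closed_normal_subgroup ?K G T"
    unfolding closed_normal_subgroup_def
  proof
    show "?K \<lhd> G" using In(1) by (rule normal_Inter)
    have "closedin T (\<Inter>(insert (topspace T) I))" using In(2) by (intro closedin_Inter) auto
    then show "closedin T ?K" by (simp add: topspace_eq_carrier)
  qed
  have "?K \<subseteq> M" if M: "maximal_closed_normal_subgroup M G T" for M
  proof (rule ccontr)
    assume nM: "\<not> ?K \<subseteq> M"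
    have Mn: "M \<lhd> G" using M by (simp add: maximal_closed_normal_subgroup_def closed_normal_subgroup_def)
    have "jointly_surjective (insert M I)"
      using maximal_closed_normal_subgroup_join[OF compact Hausdorff M K nM]
      by (intro jointly_surjective_insert[OF I(1) normal_imp_subgroup[OF In(1)] Mn])
    then have "insert M I \<in> ?\<A>" using M I(2) by simp
    then have "insert M I = I" using max by blast
    then show False using nM by blast
  qed
  then have "?K \<subseteq> normal_frattini G T" unfolding normal_frattini_def by blast
  then show ?thesis using I assms by auto
qed

end

theorem lemma2p2:
  fixes G :: "('a, 'b) monoid_scheme" and T :: "'a topology"
  assumes "profinite_group G T"
  shows "(\<forall>H. closed_normal_subgroup H G T \<longrightarrow>
            closed_subgroup
              (normal_frattini (G\<lparr>carrier := H\<rparr>) (subtopology T H))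
              (G\<lparr>carrier := normal_frattini G T\<rparr>)
              (subtopology T (normal_frattini G T)))
       \<and> (normal_frattini G T = {\<one>\<^bsub>G\<^esub>} \<longrightarrow>
            (\<exists>(I :: 'a set set) (S :: 'a set \<Rightarrow> 'a set monoid) f.
               (\<forall>i \<in> I. finite (carrier (S i)) \<and>
                  (elementary_abelian (S i) \<or> simple_group (S i) \<and> \<not> comm_group (S i))) \<and>
               topological_group_iso f G T (product_group I S)
                 (product_topology (\<lambda>i. discrete_topology (carrier (S i))) I))
            \<and> T closure_of finite_radical G = carrier G)"
proof -
  interpret profinite_group G T by fact
  show ?thesis
  proof (intro conjI allI impI)
    fix H assume "closed_normal_subgroup H G T"
    then show "closed_subgroup (normal_frattini (G\<lparr>carrier := H\<rparr>) (subtopology T H))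
        (G\<lparr>carrier := normal_frattini G T\<rparr>) (subtopology T (normal_frattini G T))"
      by (rule normal_frattini_closed_subgroup[OF compact Hausdorff])
  next
    assume "normal_frattini G T = {\<one>\<^bsub>G\<^esub>}"
    then obtain I where I: "jointly_surjective I"
      "\<forall>N\<in>I. maximal_closed_normal_subgroup N G T" "carrier G \<inter> \<Inter>I \<subseteq> {\<one>\<^bsub>G\<^esub>}"
      using exists_jointly_surjective_trivial_Inter by blast
    have N: "N \<lhd> G \<and> openin T N" if "N \<in> I" for N
    proof -
      have "maximal_closed_normal_subgroup N G T" using I(2) that by blast
      then show ?thesis
        using maximal_closed_normal_subgroup_open[of N]
        by (simp add: maximal_closed_normal_subgroup_def closed_normal_subgroup_def)
    qed
    have simple: "simple_group (G Mod N)" if "N \<in> I" for N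
      using maximal_open_normal_quotient_simple[OF compact] I(2) N[OF that] that by blast
    have fin: "finite (carrier (G Mod N))" if "N \<in> I" for N
      using open_subgroup_finite_index[OF compact normal_imp_subgroup] N[OF that]
      by (simp add: FactGroup_def)
    show "\<exists>(I :: 'a set set) (S :: 'a set \<Rightarrow> 'a set monoid) f.
        (\<forall>i \<in> I. finite (carrier (S i)) \<and>
           (elementary_abelian (S i) \<or> simple_group (S i) \<and> \<not> comm_group (S i))) \<and>
        topological_group_iso f G T (product_group I S)
          (product_topology (\<lambda>i. discrete_topology (carrier (S i))) I)"
    proof (intro exI conjI ballI)
      show "topological_group_iso (\<lambda>x. \<lambda>N\<in>I. N #>\<^bsub>G\<^esub> x) G T (product_group I (\<lambda>N. G Mod N))
          (product_topology (\<lambda>N. discrete_topology (carrier (G Mod N))) I)"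
        by (rule topological_group_iso_product_quotients[OF compact I(1) N I(3)])
      show "finite (carrier (G Mod N))" if "N \<in> I" for N using fin[OF that] .
      show "elementary_abelian (G Mod N) \<or> simple_group (G Mod N) \<and> \<not> comm_group (G Mod N)"
        if "N \<in> I" for N
        using finite_simple_abelian_elementary simple[OF that] fin[OF that] by blast
    qed
    show "T closure_of finite_radical G = carrier G"
      by (rule finite_radical_dense[OF compact I(1) N I(3)])
  qed
qed

end
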